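(* Let $P_l\in\mathbb{R}^{n_l}$ and $\overline P_m\in\mathbb{R}^{n_g}$ be given constants, and assume that there exist $\overline\eta\in\mathrm{Im}(\mathcal{B}^T)$ and $\overline\omega=(\overline\omega_g^T,\overline\omega_l^T)^T\in\mathrm{Ker}(\mathcal{B}^T)$ such that $$\boldsymbol 0=-D_g\overline\omega_g-\mathcal{B}_g\Gamma\sin(\overline\eta)+\overline P_m,\qquad \boldsymbol 0=-D_l\overline\omega_l-\mathcal{B}_l\Gamma\sin(\overline\eta)-P_l .$$ Then the system $$\dot\eta=\mathcal{B}_g^T\omega_g+\mathcal{B}_l^TD_l^{-1}\big(-\mathcal{B}_l\Gamma\sin(\eta)-P_l\big),\qquad M\dot\omega_g=-D_g\omega_g-\mathcal{B}_g\Gamma\sin(\eta)+P_m$$ with input $P_m$ and output $\omega_g$ is an output strictly incrementally cyclo-passive system with respect to $(\overline\eta,\overline\omega_g)$ satisfying $$\boldsymbol 0=\mathcal{B}_g^T\overline\omega_g+\mathcal{B}_l^TD_l^{-1}\big(-\mathcal{B}_l\Gamma\sin(\overline\eta)-P_l\big),\qquad \boldsymbol 0=-D_g\overline\omega_g-\mathcal{B}_g\Gamma\sin(\overline\eta)+\overline P_m .$$ Namely, there exists a storage function $U(\eta,\overline\eta,\omega_g,\overline\omega_g)$ which satisfies $$\dot U=-\|\omega_g-\overline\omega_g\|_{D_g}^2-\|\omega_l-\overline\omega_l\|_{D_l}^2+(\omega_g-\overline\omega_g)^T(P_m-\overline P_m),$$ where $\dot U$ is the derivative of $U$ along the solutions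 of the system, and $\omega_l=D_l^{-1}(-\mathcal{B}_l\Gamma\sin(\eta)-P_l)$, $\overline\omega_l=D_l^{-1}(-\mathcal{B}_l\Gamma\sin(\overline\eta)-P_l)$.
   Context: Network. The power network is a connected undirected graph with node set $\mathcal{V}_g\cup\mathcal{V}_l$, where $\mathcal{V}_g=\{1,\dots,n_g\}$ are the generator buses, $\mathcal{V}_l=\{n_g+1,\dots,n\}$ are the load buses, $n=n_g+n_l$, and $m$ edges. $\mathcal{B}\in\mathbb{R}^{n\times m}$ is its incidence matrix (for an arbitrary orientation); $\mathcal{B}_g\in\mathbb{R}^{n_g\times m}$ and $\mathcal{B}_l\in\mathbb{R}^{n_l\times m}$ are its row blocks indexed by $\mathcal{V}_g$ and $\mathcal{V}_l$. $\Gamma=\mathrm{diag}(\gamma_1,\dots,\gamma_m)$ with $\gamma_k=V_iV_jB_{ij}>0$ constant for line $k=\{i,j\}$. $M$, $D_g$ and $D_l$ are diagonal matrices with positive diagonal entries. $\sin(\cdot)$ acts componentwise. The state is $(\eta,\omega_g)\in\mathbb{R}^m\times\mathbb{R}^{n_g}$. Notation. $\|x\|_W^2=x^TWx$. Definition (incremental cyclo-passivity). A system $\dot x=f(x,u)$, $y=h(x)$, with $x\in\mathcal{X}$ and $u,y\in\mathbb{R}^p$, is incrementally cyclo-passive with respect to a constant triplet $(\overline x,\overline u,\overline y)$ satisfying $\boldsymbol 0=f(\overline x,\overline u)$, $\overline y=h(\overline x)$, if there exists a continuously differentiable function $\mathcal{S}$ of $x$ (with $\overline x$ as a parameter), $\mathcal{S}:\mathcal{X}\to\mathbb{R}$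 (called a storage function), such that for all $x\in\mathcal{X}$, $u\in\mathbb{R}^p$, with $y=h(x)$, $$\dot{\mathcal{S}}=\frac{\partial\mathcal{S}}{\partial x}f(x,u)+\frac{\partial\mathcal{S}}{\partial\overline x}f(\overline x,\overline u)\le-\|y-\overline y\|_W^2+(y-\overline y)^T(u-\overline u)$$ for some $W\ge 0$. If $W>0$ the system is output strictly incrementally cyclo-passive. $\mathcal{S}$ is not required to be positive definite or bounded from below. *)

theory Defs
  imports "HOL-Analysis.Analysis"
begin

section \<open>Matrices and vectors\<close>

definition diag_matrix :: "('k \<Rightarrow> real) \<Rightarrow> real ^ 'k ^ 'k" where
  "diag_matrix d = (\<chi> i j. if i = j then d i else 0)"

definition pos_diagonal :: "real ^ 'k ^ 'k \<Rightarrow> bool" where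
  "pos_diagonal A \<longleftrightarrow> (\<forall>i j. i \<noteq> j \<longrightarrow> A $ i $ j = 0) \<and> (\<forall>i. A $ i $ i > 0)"

definition pos_semidefinite :: "real ^ 'k ^ 'k \<Rightarrow> bool" where
  "pos_semidefinite W \<longleftrightarrow> transpose W = W \<and> (\<forall>x. x \<bullet> (W *v x) \<ge> 0)"

definition pos_definite :: "real ^ 'k ^ 'k \<Rightarrow> bool" where
  "pos_definite W \<longleftrightarrow> transpose W = W \<and> (\<forall>x. x \<noteq> 0 \<longrightarrow> x \<bullet> (W *v x) > 0)"

definition weighted_sqnorm :: "real ^ 'k ^ 'k \<Rightarrow> real ^ 'k \<Rightarrow> real" where
  "weighted_sqnorm W x = x \<bullet> (W *v x)"

definition sin_vec :: "real ^ 'k \<Rightarrow> real ^ 'k" where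
  "sin_vec x = (\<chi> k. sin (x $ k))"

definition stack_vec :: "real ^ 'a \<Rightarrow> real ^ 'b \<Rightarrow> real ^ ('a::finite + 'b::finite)" where
  "stack_vec x y = (\<chi> i. case i of Inl a \<Rightarrow> x $ a | Inr b \<Rightarrow> y $ b)"

definition upper_rows :: "real ^ 'm ^ ('a::finite + 'b::finite) \<Rightarrow> real ^ 'm ^ 'a" where
  "upper_rows A = (\<chi> i. A $ Inl i)"

definition lower_rows :: "real ^ 'm ^ ('a::finite + 'b::finite) \<Rightarrow> real ^ 'm ^ 'b" where
  "lower_rows A = (\<chi> i. A $ Inr i)"


section \<open>Incremental cyclo-passivity\<close>

text \<open>
  A system \<open>x' = f(x, u)\<close>, \<open>y = h(x)\<close> has state space \<open>X\<close> (meant to be open, since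
  derivatives are taken at points of \<open>X\<close> in the ambient space) and input and output in
  the same space.  A storage function takes the constant state as a second argument.
\<close>

definition continuously_differentiable_on ::
    "'x::euclidean_space set \<Rightarrow> ('x \<Rightarrow> real) \<Rightarrow> bool" where
  "continuously_differentiable_on X F \<longleftrightarrow>
     (\<exists>F'. continuous_on X F' \<and> (\<forall>x\<in>X. (F has_derivative blinfun_apply (F' x)) (at x)))"

definition storage_rate ::
    "('x::euclidean_space \<Rightarrow> real ^ 'p \<Rightarrow> 'x) \<Rightarrow> ('x \<Rightarrow> 'x \<Rightarrow> real)
      \<Rightarrow> 'x \<Rightarrow> real ^ 'p \<Rightarrow> 'x \<Rightarrow> real ^ 'p \<Rightarrow> real" where
  "storage_rate f S xbar ubar x u =
     frechet_derivative (\<lambda>z. S z xbar) (at x) (f x u)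
     + frechet_derivative (\<lambda>z. S x z) (at xbar) (f xbar ubar)"

text \<open>
  Differentiability in the second argument only makes the second summand of
  \<open>storage_rate\<close> meaningful.
\<close>

definition incremental_storage ::
    "'x::euclidean_space set \<Rightarrow> ('x \<Rightarrow> real ^ 'p \<Rightarrow> 'x) \<Rightarrow> ('x \<Rightarrow> real ^ 'p)
      \<Rightarrow> 'x \<Rightarrow> real ^ 'p \<Rightarrow> real ^ 'p \<Rightarrow> real ^ 'p ^ 'p \<Rightarrow> ('x \<Rightarrow> 'x \<Rightarrow> real) \<Rightarrow> bool" where
  "incremental_storage X f h xbar ubar ybar W S \<longleftrightarrow>
     continuously_differentiable_on X (\<lambda>x. S x xbar)
     \<and> (\<forall>x\<in>X. (\<lambda>z. S x z) differentiable (at xbar))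
     \<and> (\<forall>x\<in>X. \<forall>u. storage_rate f S xbar ubar x u
          \<le> - weighted_sqnorm W (h x - ybar) + (h x - ybar) \<bullet> (u - ubar))"

definition constant_triplet ::
    "'x::euclidean_space set \<Rightarrow> ('x \<Rightarrow> real ^ 'p \<Rightarrow> 'x) \<Rightarrow> ('x \<Rightarrow> real ^ 'p)
      \<Rightarrow> 'x \<Rightarrow> real ^ 'p \<Rightarrow> real ^ 'p \<Rightarrow> bool" where
  "constant_triplet X f h xbar ubar ybar \<longleftrightarrow> xbar \<in> X \<and> 0 = f xbar ubar \<and> ybar = h xbar"

definition incr_cyclo_passive ::
    "'x::euclidean_space set \<Rightarrow> ('x \<Rightarrow> real ^ 'p \<Rightarrow> 'x) \<Rightarrow> ('x \<Rightarrow> real ^ 'p)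
      \<Rightarrow> 'x \<Rightarrow> real ^ 'p \<Rightarrow> real ^ 'p \<Rightarrow> bool" where
  "incr_cyclo_passive X f h xbar ubar ybar \<longleftrightarrow>
     constant_triplet X f h xbar ubar ybar
     \<and> (\<exists>S W. pos_semidefinite W \<and> incremental_storage X f h xbar ubar ybar W S)"

definition output_strictly_incr_cyclo_passive ::
    "'x::euclidean_space set \<Rightarrow> ('x \<Rightarrow> real ^ 'p \<Rightarrow> 'x) \<Rightarrow> ('x \<Rightarrow> real ^ 'p)
      \<Rightarrow> 'x \<Rightarrow> real ^ 'p \<Rightarrow> real ^ 'p \<Rightarrow> bool" where
  "output_strictly_incr_cyclo_passive X f h xbar ubar ybar \<longleftrightarrow>
     constant_triplet X f h xbar ubar ybar
     \<and> (\<exists>S W. pos_definite W \<and> incremental_storage X f h xbar ubar ybar W S)"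

definition is_solution ::
    "('x::euclidean_space \<Rightarrow> 'u \<Rightarrow> 'x) \<Rightarrow> real set \<Rightarrow> (real \<Rightarrow> 'u) \<Rightarrow> (real \<Rightarrow> 'x) \<Rightarrow> bool" where
  "is_solution f T u x \<longleftrightarrow>
     is_interval T \<and> (\<forall>t\<in>T. (x has_vector_derivative f (x t) (u t)) (at t within T))"


section \<open>The power network\<close>

text \<open>
  Edge \<open>k\<close> is the unordered pair \<open>{src k, tgt k}\<close>; which endpoint is called \<open>src\<close> is an
  arbitrary orientation.
\<close>

definition connected_graph :: "('m \<Rightarrow> 'n) \<Rightarrow> ('m \<Rightarrow> 'n) \<Rightarrow> bool" where
  "connected_graph src tgt \<longleftrightarrow>
     (\<forall>k. src k \<noteq> tgt k)
     \<and> inj (\<lambda>k. {src k, tgt k})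
     \<and> (\<forall>i j. (i, j) \<in> {(a, b). \<exists>k. {a, b} = {src k, tgt k}}\<^sup>*)"

definition incidence_matrix :: "('m \<Rightarrow> 'n) \<Rightarrow> ('m \<Rightarrow> 'n) \<Rightarrow> real ^ 'm ^ 'n" where
  "incidence_matrix src tgt =
     (\<chi> i k. if i = tgt k then 1 else if i = src k then - 1 else 0)"

definition line_weight ::
    "('n \<Rightarrow> real) \<Rightarrow> ('n \<Rightarrow> 'n \<Rightarrow> real) \<Rightarrow> ('m \<Rightarrow> 'n) \<Rightarrow> ('m \<Rightarrow> 'n) \<Rightarrow> 'm \<Rightarrow> real" where
  "line_weight V Bsus src tgt k = V (src k) * V (tgt k) * Bsus (src k) (tgt k)"

text \<open>The algebraic load frequency \<open>\<omega>\<^sub>l\<close> determined by \<open>\<eta>\<close>.\<close>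

definition load_freq ::
    "real ^ 'm ^ 'l \<Rightarrow> real ^ 'm ^ 'm \<Rightarrow> real ^ 'l ^ 'l \<Rightarrow> real ^ 'l \<Rightarrow> real ^ 'm \<Rightarrow> real ^ 'l" where
  "load_freq Bl \<Gamma> Dl Pl \<eta> = matrix_inv Dl *v (- (Bl *v (\<Gamma> *v sin_vec \<eta>)) - Pl)"

text \<open>
  The state is \<open>(\<eta>, \<omega>\<^sub>g)\<close> and the input is \<open>P\<^sub>m\<close>; the second component is the swing
  equation solved for \<open>\<omega>\<^sub>g'\<close>.
\<close>

definition network_dynamics ::
    "real ^ 'm ^ 'g \<Rightarrow> real ^ 'm ^ 'l \<Rightarrow> real ^ 'm ^ 'm \<Rightarrow> real ^ 'g ^ 'g \<Rightarrow> real ^ 'g ^ 'g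
      \<Rightarrow> real ^ 'l ^ 'l \<Rightarrow> real ^ 'l
      \<Rightarrow> (real ^ 'm) \<times> (real ^ 'g) \<Rightarrow> real ^ 'g \<Rightarrow> (real ^ 'm) \<times> (real ^ 'g)" where
  "network_dynamics Bg Bl \<Gamma> M Dg Dl Pl = (\<lambda>(\<eta>, \<omega>g) Pm.
     (transpose Bg *v \<omega>g
        + transpose Bl *v (matrix_inv Dl *v (- (Bl *v (\<Gamma> *v sin_vec \<eta>)) - Pl)),
      matrix_inv M *v (- (Dg *v \<omega>g) - Bg *v (\<Gamma> *v sin_vec \<eta>) + Pm)))"

end

theory Submission
  imports Defs
begin

text \<open>
  The storage function is kinetic energy plus the Bregman divergence of the potential
  \<open>- \<Sum> \<gamma>\<^sub>k cos \<eta>\<^sub>k\<close>; its gradient in the state is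
  \<open>(\<Gamma> (sin \<eta> - sin \<eta>bar), M (\<omega>g - \<omega>gbar))\<close>.  Paired with the vector field, the two terms
  that couple \<open>\<eta>\<close> and \<open>\<omega>g\<close> through \<open>Bg\<close> cancel, while
  \<open>Bl \<Gamma> (sin \<eta> - sin \<eta>bar) = - Dl (\<omega>l - \<omega>lbar)\<close> turns the load term into dissipation.
\<close>

section \<open>Diagonal and positive definite matrices, block transposes\<close>

lemma pos_diagonal_eq_diag_matrix:
  assumes "pos_diagonal A"
  shows "A = diag_matrix (\<lambda>i. A $ i $ i)"
  using assms by (auto simp: pos_diagonal_def diag_matrix_def vec_eq_iff)

lemma diag_matrix_mult_vec: "diag_matrix d *v x = (\<chi> i. d i * x $ i)"
  by (simp add: diag_matrix_def matrix_vector_mult_def vec_eq_iff if_distrib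
      if_distribR sum.delta cong: if_cong)

lemma transpose_diag_matrix: "transpose (diag_matrix d) = diag_matrix d"
  by (simp add: diag_matrix_def transpose_def vec_eq_iff)

text \<open>The quadratic form is a weighted sum of squares with positive weights, so one nonzero
  coordinate makes it positive.\<close>

lemma pos_diagonal_pos_definite:
  assumes "pos_diagonal A"
  shows "pos_definite A"
  unfolding pos_definite_def
proof (intro conjI allI impI)
  show "transpose A = A"
    by (metis assms pos_diagonal_eq_diag_matrix transpose_diag_matrix)
next
  fix x :: "real ^ 'a"
  assume "x \<noteq> 0"
  then obtain k where k: "x $ k \<noteq> 0"
    by (auto simp: vec_eq_iff)
  have pos: "A $ i $ i > 0" for i
    using assms by (simp add: pos_diagonal_def)
  have "x \<bullet> (A *v x) = (\<Sum>i\<in>UNIV. A $ i $ i * (x $ i)\<^sup>2)"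
    by (subst pos_diagonal_eq_diag_matrix[OF assms])
      (simp add: diag_matrix_mult_vec inner_vec_def power2_eq_square mult_ac)
  also have "\<dots> > 0"
    using pos k by (intro sum_pos2[where i = k]) (auto simp: less_imp_le)
  finally show "x \<bullet> (A *v x) > 0" .
qed

text \<open>If \<open>A *v x = 0\<close>, the quadratic form vanishes at \<open>x\<close>, so the
  kernel is trivial; for a square matrix this suffices.\<close>

lemma pos_definite_invertible:
  fixes A :: "real ^ 'k ^ 'k"
  assumes "pos_definite A"
  shows "invertible A"
proof -
  have "A *v x = 0 \<Longrightarrow> x = 0" for x
    using assms unfolding pos_definite_def by (metis inner_zero_right less_irrefl)
  then show ?thesis
    using matrix_left_invertible_ker[of A] invertible_left_inverse by blast
qed

lemma mult_matrix_inv_cancel: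
  fixes A :: "real ^ 'k ^ 'k"
  assumes "invertible A"
  shows "A *v (matrix_inv A *v x) = x" and "matrix_inv A *v (A *v x) = x"
proof -
  \<comment> \<open>\<open>matrix_inv\<close> is a choice among two-sided inverses, so existence of
    one gives both identities.\<close>
  have "A ** matrix_inv A = mat 1 \<and> matrix_inv A ** A = mat 1"
    using assms unfolding invertible_def matrix_inv_def by (rule someI_ex)
  then show "A *v (matrix_inv A *v x) = x" and "matrix_inv A *v (A *v x) = x"
    by (simp_all add: matrix_vector_mul_assoc)
qed

text \<open>A sum over the buses splits into generators and loads; this puts the kernel condition on
  the frequencies into block form.\<close>

lemma transpose_mult_stack_vec:
  "transpose A *v stack_vec x y
    = transpose (upper_rows A) *v x + transpose (lower_rows A) *v y"
  by (simp add: vec_eq_iff matrix_vector_mult_def transpose_def stack_vec_def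
      upper_rows_def lower_rows_def UNIV_Plus_UNIV[symmetric] sum.Plus del: UNIV_Plus_UNIV)

section \<open>The storage function and its derivatives\<close>

text \<open>The first argument is the current state, the second the reference state. Since
  \<open>- cos\<close> is not convex, the value can be negative, which cyclo-passivity
  permits.\<close>

definition bregman_energy ::
    "('m::finite \<Rightarrow> real) \<Rightarrow> real ^ 'g ^ 'g
      \<Rightarrow> (real ^ 'm) \<times> (real ^ 'g) \<Rightarrow> (real ^ 'm) \<times> (real ^ 'g) \<Rightarrow> real" where
  "bregman_energy \<gamma> M x z =
     (snd x - snd z) \<bullet> (M *v (snd x - snd z)) / 2
     + (\<Sum>k\<in>UNIV. \<gamma> k * (cos (fst z $ k) - cos (fst x $ k)
          - sin (fst z $ k) * (fst x $ k - fst z $ k)))"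

definition energy_gradient ::
    "('m::finite \<Rightarrow> real) \<Rightarrow> real ^ 'g ^ 'g
      \<Rightarrow> (real ^ 'm) \<times> (real ^ 'g) \<Rightarrow> (real ^ 'm) \<times> (real ^ 'g) \<Rightarrow> (real ^ 'm) \<times> (real ^ 'g)" where
  "energy_gradient \<gamma> M x z =
     (diag_matrix \<gamma> *v (sin_vec (fst x) - sin_vec (fst z)), M *v (snd x - snd z))"

lemma has_derivative_vec_nth_fst [derivative_intros]:
  "((\<lambda>x. fst x $ k) has_derivative (\<lambda>h. fst h $ k)) F"
  by (intro bounded_linear_imp_has_derivative bounded_linear_compose[OF bounded_linear_vec_nth]
      bounded_linear_fst)

lemma bregman_energy_has_derivative:
  assumes "transpose M = M"
  shows "((\<lambda>x. bregman_energy \<gamma> M x z) has_derivative (\<lambda>h. h \<bullet> energy_gradient \<gamma> M x z)) (at x)"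
proof -
  \<comment> \<open>Symmetry makes the two product rule terms of the kinetic energy equal, which
    cancels the factor 1/2.\<close>
  have sym: "a \<bullet> (M *v b) = b \<bullet> (M *v a)" for a b
    by (metis assms dot_lmul_matrix inner_commute vector_transpose_matrix)
  have [derivative_intros]:
    "((\<lambda>x. M *v (snd x - snd z)) has_derivative (\<lambda>h. M *v snd h)) (at x)"
    by (rule bounded_linear.has_derivative[OF matrix_vector_mul_bounded_linear])
      (auto intro!: derivative_eq_intros)
  show ?thesis
    unfolding bregman_energy_def
    apply (rule derivative_eq_intros refl | simp)+
    by (auto simp: fun_eq_iff energy_gradient_def inner_prod_def sym[of "snd x - snd z"]
        diag_matrix_mult_vec sin_vec_def inner_vec_def[of "fst _"] field_simps sum.distrib
        sum_subtractf matrix_vector_mult_diff_distrib)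
qed

text \<open>Existence of the derivative in the reference state is enough: the storage rate applies
  it to the vector field at equilibrium, which is zero.\<close>

lemma bregman_energy_differentiable:
  "bregman_energy \<gamma> M x differentiable (at z)"
proof -
  have [derivative_intros]:
    "((\<lambda>z. M *v (snd x - snd z)) has_derivative (\<lambda>h. M *v (- snd h))) (at z)"
    by (rule bounded_linear.has_derivative[OF matrix_vector_mul_bounded_linear])
      (auto intro!: derivative_eq_intros)
  show ?thesis
    unfolding bregman_energy_def differentiable_def
    by (rule exI) (rule derivative_eq_intros refl | simp)+
qed

lemma bregman_energy_continuously_differentiable:
  assumes "transpose M = M"
  shows "continuously_differentiable_on X (\<lambda>x. bregman_energy \<gamma> M x z)"
  unfolding continuously_differentiable_on_def
proof (intro exI conjI ballI)
  have "continuous_on X (\<lambda>x. energy_gradient \<gamma> M x z)"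
    unfolding energy_gradient_def sin_vec_def
    by (intro continuous_intros bounded_linear.continuous_on[OF matrix_vector_mul_bounded_linear])
  \<comment> \<open>Turning a gradient into the functional it represents is bounded linear, so
    continuity carries over.\<close>
  then show "continuous_on X (\<lambda>x. blinfun_inner_left (energy_gradient \<gamma> M x z))"
    by (rule bounded_linear.continuous_on[OF bounded_linear_blinfun_inner_left])
  show "((\<lambda>x. bregman_energy \<gamma> M x z) has_derivative
      blinfun_apply (blinfun_inner_left (energy_gradient \<gamma> M x z))) (at x)" for x
    using bregman_energy_has_derivative[OF assms]
    by (simp add: blinfun_inner_left.rep_eq)
qed

lemma bregman_energy_storage_rate:
  assumes "transpose M = M" and "f xbar ubar = 0"
  shows "storage_rate f (bregman_energy \<gamma> M) xbar ubar x u
    = f x u \<bullet> energy_gradient \<gamma> M x xbar"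
proof -
  have "linear (frechet_derivative (bregman_energy \<gamma> M x) (at xbar))"
    by (rule linear_frechet_derivative[OF bregman_energy_differentiable])
  then show ?thesis
    using frechet_derivative_at[OF bregman_energy_has_derivative[OF assms(1), of \<gamma> xbar x], symmetric]
    by (simp add: storage_rate_def assms(2) linear_0)
qed

section \<open>The energy balance of the network\<close>

text \<open>Only linear algebra is left: subtracting the equilibrium equations expresses both
  factors through increments, and transposes then move across the inner product.\<close>

lemma network_energy_balance:
  fixes Bg :: "real ^ 'm::finite ^ 'g::finite" and Bl :: "real ^ 'm ^ 'l::finite"
    and M Dg :: "real ^ 'g ^ 'g" and Dl :: "real ^ 'l ^ 'l"
  assumes M: "transpose M = M" "invertible M" and Dl: "invertible Dl"
    and ker: "transpose Bg *v \<omega>gbar + transpose Bl *v \<omega>lbar = 0"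
    and gen: "0 = - (Dg *v \<omega>gbar) - Bg *v (diag_matrix \<gamma> *v sin_vec \<eta>bar) + Pmbar"
    and load: "0 = - (Dl *v \<omega>lbar) - Bl *v (diag_matrix \<gamma> *v sin_vec \<eta>bar) - Pl"
  shows "network_dynamics Bg Bl (diag_matrix \<gamma>) M Dg Dl Pl (\<eta>, \<omega>g) Pm
      \<bullet> energy_gradient \<gamma> M (\<eta>, \<omega>g) (\<eta>bar, \<omega>gbar)
    = - weighted_sqnorm Dg (\<omega>g - \<omega>gbar)
      - weighted_sqnorm Dl (load_freq Bl (diag_matrix \<gamma>) Dl Pl \<eta> - \<omega>lbar)
      + (\<omega>g - \<omega>gbar) \<bullet> (Pm - Pmbar)"
proof -
  define \<omega>l where "\<omega>l = load_freq Bl (diag_matrix \<gamma>) Dl Pl \<eta>"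
  define s where "s = diag_matrix \<gamma> *v (sin_vec \<eta> - sin_vec \<eta>bar)"
  define v where "v = - (Dg *v \<omega>g) - Bg *v (diag_matrix \<gamma> *v sin_vec \<eta>) + Pm"
  have Dl_\<omega>l: "Dl *v \<omega>l = - (Bl *v (diag_matrix \<gamma> *v sin_vec \<eta>)) - Pl"
    by (simp add: \<omega>l_def load_freq_def mult_matrix_inv_cancel[OF Dl])
  have Dl_\<omega>lbar: "Dl *v \<omega>lbar = - (Bl *v (diag_matrix \<gamma> *v sin_vec \<eta>bar)) - Pl"
    using load by (simp add: eq_neg_iff_add_eq_0 algebra_simps)
  \<comment> \<open>The constant load \<open>Pl\<close> drops out of the difference of the two load
    balances.\<close>
  have Bls: "Bl *v s = - (Dl *v (\<omega>l - \<omega>lbar))"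
    using Dl_\<omega>lbar by (simp add: s_def Dl_\<omega>l matrix_vector_mult_diff_distrib)
  have v: "v = - (Dg *v (\<omega>g - \<omega>gbar)) - Bg *v s + (Pm - Pmbar)"
    using gen by (simp add: v_def s_def matrix_vector_mult_diff_distrib algebra_simps)
  \<comment> \<open>By \<open>ker\<close> the constant frequencies contribute zero, so they may be
    subtracted.\<close>
  have d\<eta>: "transpose Bg *v \<omega>g + transpose Bl *v \<omega>l
      = transpose Bg *v (\<omega>g - \<omega>gbar) + transpose Bl *v (\<omega>l - \<omega>lbar)"
    using ker by (simp add: matrix_vector_mult_diff_distrib algebra_simps)
  have adj: "(transpose A *v x) \<bullet> y = x \<bullet> (A *v y)" for A :: "real ^ 'a ^ 'b" and x y
    by (simp add: dot_lmul_matrix)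
  have "network_dynamics Bg Bl (diag_matrix \<gamma>) M Dg Dl Pl (\<eta>, \<omega>g) Pm
      \<bullet> energy_gradient \<gamma> M (\<eta>, \<omega>g) (\<eta>bar, \<omega>gbar)
    = (transpose Bg *v \<omega>g + transpose Bl *v \<omega>l) \<bullet> s
      + (matrix_inv M *v v) \<bullet> (M *v (\<omega>g - \<omega>gbar))"
    by (simp add: network_dynamics_def energy_gradient_def s_def \<omega>l_def v_def load_freq_def)
  \<comment> \<open>\<open>M\<close> is symmetric, so it moves to the left factor and cancels its
    inverse.\<close>
  also have "(matrix_inv M *v v) \<bullet> (M *v (\<omega>g - \<omega>gbar)) = v \<bullet> (\<omega>g - \<omega>gbar)"
    using adj[of M "matrix_inv M *v v"] by (simp add: M mult_matrix_inv_cancel)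
  also have "(transpose Bg *v \<omega>g + transpose Bl *v \<omega>l) \<bullet> s
      = (\<omega>g - \<omega>gbar) \<bullet> (Bg *v s) - (\<omega>l - \<omega>lbar) \<bullet> (Dl *v (\<omega>l - \<omega>lbar))"
    unfolding d\<eta> inner_add_left adj by (simp add: Bls)
  \<comment> \<open>By \<open>v\<close>, the term with \<open>Bg *v s\<close> occurs a second time
    with the opposite sign, and the coupling cancels.\<close>
  finally show ?thesis
    unfolding v weighted_sqnorm_def \<omega>l_def[symmetric] inner_add_left inner_diff_left[of "- _"]
      inner_minus_left
    by (simp add: inner_commute)
qed

text \<open>The derivative of \<open>U\<close> is expressed twice for the same \<open>U\<close>: as
  \<open>storage_rate\<close> at every state and input, and as a time derivative along every
  solution.\<close>

theorem lemma3:
  fixes src tgt :: "'m::finite \<Rightarrow> 'g::finite + 'l::finite"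
    and V :: "'g + 'l \<Rightarrow> real" and Bsus :: "'g + 'l \<Rightarrow> 'g + 'l \<Rightarrow> real"
    and B :: "real ^ 'm ^ ('g + 'l)" and Bg :: "real ^ 'm ^ 'g" and Bl :: "real ^ 'm ^ 'l"
    and \<Gamma> :: "real ^ 'm ^ 'm"
    and M Dg :: "real ^ 'g ^ 'g" and Dl :: "real ^ 'l ^ 'l"
    and Pl :: "real ^ 'l" and Pmbar :: "real ^ 'g"
    and \<eta>bar :: "real ^ 'm" and \<omega>gbar :: "real ^ 'g" and \<omega>lbar :: "real ^ 'l"
    and f :: "(real ^ 'm) \<times> (real ^ 'g) \<Rightarrow> real ^ 'g \<Rightarrow> (real ^ 'm) \<times> (real ^ 'g)"
  assumes graph: "connected_graph src tgt"
    and Bsus_sym: "\<And>i j. Bsus i j = Bsus j i"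
    and weight_pos: "\<And>k. line_weight V Bsus src tgt k > 0"
    and B: "B = incidence_matrix src tgt"
    and Bg: "Bg = upper_rows B" and Bl: "Bl = lower_rows B"
    and Gamma: "\<Gamma> = diag_matrix (line_weight V Bsus src tgt)"
    and M: "pos_diagonal M" and Dg: "pos_diagonal Dg" and Dl: "pos_diagonal Dl"
    and eta_im: "\<eta>bar \<in> range (\<lambda>v. transpose B *v v)"
    and omega_ker: "transpose B *v stack_vec \<omega>gbar \<omega>lbar = 0"
    and eq_gen: "0 = - (Dg *v \<omega>gbar) - Bg *v (\<Gamma> *v sin_vec \<eta>bar) + Pmbar"
    and eq_load: "0 = - (Dl *v \<omega>lbar) - Bl *v (\<Gamma> *v sin_vec \<eta>bar) - Pl"
    and f: "f = network_dynamics Bg Bl \<Gamma> M Dg Dl Pl"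
  shows "output_strictly_incr_cyclo_passive UNIV f snd (\<eta>bar, \<omega>gbar) Pmbar \<omega>gbar
    \<and> 0 = transpose Bg *v \<omega>gbar
          + transpose Bl *v (matrix_inv Dl *v (- (Bl *v (\<Gamma> *v sin_vec \<eta>bar)) - Pl))
    \<and> 0 = - (Dg *v \<omega>gbar) - Bg *v (\<Gamma> *v sin_vec \<eta>bar) + Pmbar
    \<and> \<omega>lbar = load_freq Bl \<Gamma> Dl Pl \<eta>bar
    \<and> (\<exists>U W. pos_definite W
        \<and> incremental_storage UNIV f snd (\<eta>bar, \<omega>gbar) Pmbar \<omega>gbar W U
        \<and> (\<forall>\<eta> \<omega>g Pm.
             storage_rate f U (\<eta>bar, \<omega>gbar) Pmbar (\<eta>, \<omega>g) Pm
             = - weighted_sqnorm Dg (\<omega>g - \<omega>gbar)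
               - weighted_sqnorm Dl (load_freq Bl \<Gamma> Dl Pl \<eta> - \<omega>lbar)
               + (\<omega>g - \<omega>gbar) \<bullet> (Pm - Pmbar))
        \<and> (\<forall>T Pm \<eta> \<omega>g. is_solution f T Pm (\<lambda>t. (\<eta> t, \<omega>g t)) \<longrightarrow>
             (\<forall>t\<in>T. ((\<lambda>s. U (\<eta> s, \<omega>g s) (\<eta>bar, \<omega>gbar)) has_real_derivative
               (- weighted_sqnorm Dg (\<omega>g t - \<omega>gbar)
                - weighted_sqnorm Dl (load_freq Bl \<Gamma> Dl Pl (\<eta> t) - \<omega>lbar)
                + (\<omega>g t - \<omega>gbar) \<bullet> (Pm t - Pmbar))) (at t within T))))"
proof -
  define \<gamma> where "\<gamma> = line_weight V Bsus src tgt"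
  define U where "U = bregman_energy \<gamma> M"
  note \<Gamma> = Gamma[folded \<gamma>_def]
  have M': "transpose M = M" "invertible M"
    using pos_diagonal_pos_definite[OF M] pos_definite_invertible
    by (auto simp: pos_definite_def)
  have Dl': "invertible Dl"
    using pos_definite_invertible pos_diagonal_pos_definite Dl by blast
  have ker: "transpose Bg *v \<omega>gbar + transpose Bl *v \<omega>lbar = 0"
    using omega_ker unfolding transpose_mult_stack_vec Bg Bl .
  have "Dl *v \<omega>lbar = - (Bl *v (\<Gamma> *v sin_vec \<eta>bar)) - Pl"
    using eq_load by (simp add: eq_neg_iff_add_eq_0 algebra_simps)
  then have \<omega>lbar: "\<omega>lbar = load_freq Bl \<Gamma> Dl Pl \<eta>bar"
    unfolding load_freq_def by (metis mult_matrix_inv_cancel(2)[OF Dl'])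
  have eq_angle: "0 = transpose Bg *v \<omega>gbar
      + transpose Bl *v (matrix_inv Dl *v (- (Bl *v (\<Gamma> *v sin_vec \<eta>bar)) - Pl))"
    using ker \<omega>lbar by (simp add: load_freq_def)
  have f0: "f (\<eta>bar, \<omega>gbar) Pmbar = 0"
    using eq_angle eq_gen by (simp add: f network_dynamics_def zero_prod_def)
  have balance: "f (\<eta>, \<omega>g) Pm \<bullet> energy_gradient \<gamma> M (\<eta>, \<omega>g) (\<eta>bar, \<omega>gbar)
      = - weighted_sqnorm Dg (\<omega>g - \<omega>gbar)
        - weighted_sqnorm Dl (load_freq Bl \<Gamma> Dl Pl \<eta> - \<omega>lbar)
        + (\<omega>g - \<omega>gbar) \<bullet> (Pm - Pmbar)" for \<eta> \<omega>g Pm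
    using network_energy_balance[OF M' Dl' ker] eq_gen eq_load unfolding f \<Gamma> by blast
  have rate: "storage_rate f U (\<eta>bar, \<omega>gbar) Pmbar (\<eta>, \<omega>g) Pm
      = - weighted_sqnorm Dg (\<omega>g - \<omega>gbar)
        - weighted_sqnorm Dl (load_freq Bl \<Gamma> Dl Pl \<eta> - \<omega>lbar)
        + (\<omega>g - \<omega>gbar) \<bullet> (Pm - Pmbar)" for \<eta> \<omega>g Pm
    using bregman_energy_storage_rate[OF M'(1), of f, OF f0] balance by (simp add: U_def)
  \<comment> \<open>Dropping the load dissipation turns the exact balance into the passivity
    inequality with weight \<open>W = Dg\<close>.\<close>
  have Dl_nonneg: "weighted_sqnorm Dl x \<ge> 0" for x
    using pos_diagonal_pos_definite[OF Dl]
    by (cases "x = 0") (auto simp: weighted_sqnorm_def pos_definite_def less_imp_le)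
  have storage: "incremental_storage UNIV f snd (\<eta>bar, \<omega>gbar) Pmbar \<omega>gbar Dg U"
    unfolding incremental_storage_def
    using bregman_energy_continuously_differentiable[OF M'(1)] bregman_energy_differentiable
    by (auto simp: rate Dl_nonneg) (auto simp: U_def)
  have along: "((\<lambda>s. U (\<eta> s, \<omega>g s) (\<eta>bar, \<omega>gbar)) has_real_derivative
      (- weighted_sqnorm Dg (\<omega>g t - \<omega>gbar)
       - weighted_sqnorm Dl (load_freq Bl \<Gamma> Dl Pl (\<eta> t) - \<omega>lbar)
       + (\<omega>g t - \<omega>gbar) \<bullet> (Pm t - Pmbar))) (at t within T)"
    if "is_solution f T Pm (\<lambda>t. (\<eta> t, \<omega>g t))" and "t \<in> T" for T Pm \<eta> \<omega>g t
  proof -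
    have "((\<lambda>t. (\<eta> t, \<omega>g t)) has_derivative (\<lambda>h. h *\<^sub>R f (\<eta> t, \<omega>g t) (Pm t))) (at t within T)"
      using that by (simp add: is_solution_def has_vector_derivative_def)
    \<comment> \<open>By the chain rule the time derivative is the vector field paired with the
      gradient, which \<open>balance\<close> evaluates; at endpoints of \<open>T\<close> it is
      one-sided.\<close>
    from has_derivative_compose[OF this bregman_energy_has_derivative[OF M'(1)]]
    show ?thesis
      by (simp add: U_def has_field_derivative_def balance[symmetric] mult_commute_abs)
  qed
  have triplet: "constant_triplet UNIV f snd (\<eta>bar, \<omega>gbar) Pmbar \<omega>gbar"
    by (simp add: constant_triplet_def f0)
  show ?thesis
    unfolding output_strictly_incr_cyclo_passive_def
    using triplet pos_diagonal_pos_definite[OF Dg] storage eq_angle eq_gen \<omega>lbar rate along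
    by blast
qed

end
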